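(* Let $(\Omega,\mathscr{F},\mu)$ be a probability space and let $(\mathscr{E},\mathscr{D}(\mathscr{E}))$ be a symmetric Dirichlet form on $L^2(\Omega;\mu)$ such that $\mathscr{E}(f,1)=0$ for all $f\in\mathscr{D}(\mathscr{E})$. The following statements hold. (1) Suppose that the super-Poincaré inequality (SPI) holds with rate function $\beta_{\mathrm{SP}}$. For $t>0$ set $$\xi_1(t):=\inf\left\{\frac{r}{1-t\beta_{\mathrm{SP}}(r)}\;:\; r>0 \text{ such that } 1-t\beta_{\mathrm{SP}}(r)>0\right\},$$ with the convention $\inf\emptyset=-\infty$, and suppose that, for some constant $\delta>2$, $$\lim_{n\to\infty} n\,\xi_1(\delta^{-n+1})=0 .$$ Then there exist constants $C_4>0$, $s_0>0$ and a positive integer $n_0$ such that the super log-Sobolev inequality (SLSI) holds with the rate function $$\beta_{\mathrm{SL}}(s):=\begin{cases}(\log\delta)\,(1+N_0(s)), & s\in(0,s_0],\\ \beta_{\mathrm{SL}}(s_0), & s\in(s_0,+\infty),\end{cases}$$ where $$N_0(s):=\sup\left\{n\ge n_0 \text{ an integer}\;:\; C_4\,n\,\xi_1\left(\delta^{-n+1}\right)>s\right\}.$$ (2) Suppose that the SLSI holds with rate function $\beta_{\mathrm{SL}}$. For $t>0$ set $$\xi_2(t):=\inf\left\{\frac{r}{t-\beta_{\mathrm{SL}}(r)}\;:\; r>0 \text{ such that } t-\beta_{\mathrm{SL}}(r)>0\right\},$$ with the convention $\inf\emptyset=-\infty$. Then there exist constants $C_5>0$, $C_6>0$, $\delta>2$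 and an integer $n_0\ge 2$ such that the SPI holds with the rate function $$\beta_{\mathrm{SP}}(s):=C_5\inf\left\{\delta^k\;:\; k\ge n_0 \text{ an integer such that } \xi_2(k\log\delta)\le C_6 s\right\},\qquad s>0.$$
   Context: For an integrable function $g$ write $\mu(g):=\int_\Omega g\,d\mu$. The entropy of $f^2$ is $\mathrm{Ent}_\mu(f^2):=\mu(f^2\log f^2)-\mu(f^2)\log\mu(f^2)$. Super-Poincaré inequality (SPI) with rate function $\beta_{\mathrm{SP}}$: $\beta_{\mathrm{SP}}:(0,\infty)\to[0,\infty)$ is non-increasing and $$\mu(f^2)\le s\,\mathscr{E}(f,f)+\beta_{\mathrm{SP}}(s)\,\mu(|f|)^2,\qquad s>0,\ f\in\mathscr{D}(\mathscr{E}).$$ Super log-Sobolev inequality (SLSI) with rate function $\beta_{\mathrm{SL}}$: $\beta_{\mathrm{SL}}:(0,\infty)\to[0,\infty)$ is non-increasing and $$\mathrm{Ent}_\mu(f^2)\le s\,\mathscr{E}(f,f)+\beta_{\mathrm{SL}}(s)\,\mu(f^2),\qquad s>0,\ f\in\mathscr{D}(\mathscr{E}).$$ The constants asserted to exist may depend on $\mu$, $\mathscr{E}$ and the given rate functions. *)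

theory Defs
  imports "HOL-Probability.Probability"
begin

text \<open>
  Elements of \<open>L\<^sup>2\<close> are represented by square-integrable functions; identification of functions
  that agree almost everywhere is imposed on the domain and on the form by the condition
  \<open>AE_invariant\<close> of the locale below.
\<close>

definition L2 :: "'a measure \<Rightarrow> ('a \<Rightarrow> real) set" where
  "L2 M = {f \<in> borel_measurable M. integrable M (\<lambda>x. (f x)\<^sup>2)}"

definition energy1 ::
    "'a measure \<Rightarrow> (('a \<Rightarrow> real) \<Rightarrow> ('a \<Rightarrow> real) \<Rightarrow> real) \<Rightarrow> ('a \<Rightarrow> real) \<Rightarrow> real" where
  "energy1 M E f = E f f + (\<integral>x. (f x)\<^sup>2 \<partial>M)"

text \<open>\<open>closed\<close> is completeness of \<open>D\<close> for the norm \<open>(E(f,f) + \<mu>(f\<^sup>2))\<^sup>1\<^sup>/\<^sup>2\<close>.\<close>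

locale symmetric_dirichlet_form =
  fixes M :: "'a measure"
    and D :: "('a \<Rightarrow> real) set"
    and E :: "('a \<Rightarrow> real) \<Rightarrow> ('a \<Rightarrow> real) \<Rightarrow> real"
  assumes domain: "D \<subseteq> L2 M"
    and AE_invariant: "\<And>f g. f \<in> D \<Longrightarrow> g \<in> borel_measurable M \<Longrightarrow> (AE x in M. f x = g x)
          \<Longrightarrow> g \<in> D \<and> (\<forall>h\<in>D. E g h = E f h)"
    and zero: "(\<lambda>_. 0) \<in> D"
    and add: "\<And>f g. f \<in> D \<Longrightarrow> g \<in> D \<Longrightarrow> (\<lambda>x. f x + g x) \<in> D"
    and scale: "\<And>f c. f \<in> D \<Longrightarrow> (\<lambda>x. c * f x) \<in> D"
    and dense: "\<And>f \<epsilon>. f \<in> L2 M \<Longrightarrow> 0 < \<epsilon> \<Longrightarrow> \<exists>g\<in>D. (\<integral>x. (f x - g x)\<^sup>2 \<partial>M) < \<epsilon>"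
    and form_add: "\<And>f g h. f \<in> D \<Longrightarrow> g \<in> D \<Longrightarrow> h \<in> D
          \<Longrightarrow> E (\<lambda>x. f x + g x) h = E f h + E g h"
    and form_scale: "\<And>f h c. f \<in> D \<Longrightarrow> h \<in> D \<Longrightarrow> E (\<lambda>x. c * f x) h = c * E f h"
    and symmetric: "\<And>f g. f \<in> D \<Longrightarrow> g \<in> D \<Longrightarrow> E f g = E g f"
    and nonneg: "\<And>f. f \<in> D \<Longrightarrow> 0 \<le> E f f"
    and closed: "\<And>u :: nat \<Rightarrow> 'a \<Rightarrow> real. (\<And>n. u n \<in> D) \<Longrightarrow>
          (\<And>\<epsilon>. 0 < \<epsilon> \<Longrightarrow> \<exists>N. \<forall>m\<ge>N. \<forall>n\<ge>N. energy1 M E (\<lambda>x. u m x - u n x) < \<epsilon>)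
          \<Longrightarrow> \<exists>f\<in>D. (\<lambda>n. energy1 M E (\<lambda>x. u n x - f x)) \<longlonglongrightarrow> 0"
    and markov: "\<And>f. f \<in> D \<Longrightarrow> (\<lambda>x. min (max (f x) 0) 1) \<in> D \<and>
          E (\<lambda>x. min (max (f x) 0) 1) (\<lambda>x. min (max (f x) 0) 1) \<le> E f f"

text \<open>
  For \<open>g \<ge> 0\<close> integrable with respect to a probability measure, \<open>g log g \<ge> -1/e\<close>, so \<open>\<mu>(g log g)\<close>
  always makes sense in \<open>(-\<infinity>, \<infinity>]\<close>, and equals \<open>\<infinity>\<close> exactly when \<open>g log g\<close> is not integrable.
  The convention \<open>0 log 0 = 0\<close> is automatic.
\<close>

definition Ent :: "'a measure \<Rightarrow> ('a \<Rightarrow> real) \<Rightarrow> ereal" where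
  "Ent M g =
     (if integrable M (\<lambda>x. g x * ln (g x))
      then ereal ((\<integral>x. g x * ln (g x) \<partial>M) - (\<integral>x. g x \<partial>M) * ln (\<integral>x. g x \<partial>M))
      else \<infinity>)"

definition rate_function :: "(real \<Rightarrow> real) \<Rightarrow> bool" where
  "rate_function \<beta> \<longleftrightarrow> (\<forall>s>0. 0 \<le> \<beta> s) \<and> antimono_on {0<..} \<beta>"

definition SPI ::
    "'a measure \<Rightarrow> ('a \<Rightarrow> real) set \<Rightarrow> (('a \<Rightarrow> real) \<Rightarrow> ('a \<Rightarrow> real) \<Rightarrow> real)
      \<Rightarrow> (real \<Rightarrow> real) \<Rightarrow> bool" where
  "SPI M D E \<beta> \<longleftrightarrow> rate_function \<beta> \<and>
     (\<forall>s>0. \<forall>f\<in>D. (\<integral>x. (f x)\<^sup>2 \<partial>M) \<le> s * E f f + \<beta> s * (\<integral>x. \<bar>f x\<bar> \<partial>M)\<^sup>2)"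

definition SLSI ::
    "'a measure \<Rightarrow> ('a \<Rightarrow> real) set \<Rightarrow> (('a \<Rightarrow> real) \<Rightarrow> ('a \<Rightarrow> real) \<Rightarrow> real)
      \<Rightarrow> (real \<Rightarrow> real) \<Rightarrow> bool" where
  "SLSI M D E \<beta> \<longleftrightarrow> rate_function \<beta> \<and>
     (\<forall>s>0. \<forall>f\<in>D. Ent M (\<lambda>x. (f x)\<^sup>2) \<le> ereal (s * E f f + \<beta> s * (\<integral>x. (f x)\<^sup>2 \<partial>M)))"

text \<open>The infimum of the empty set is \<open>-\<infinity>\<close> here, whereas it is \<open>\<infinity>\<close> for \<^term>\<open>Inf\<close> on \<^typ>\<open>ereal\<close>.\<close>

definition \<xi>1 :: "(real \<Rightarrow> real) \<Rightarrow> real \<Rightarrow> ereal" where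
  "\<xi>1 \<beta> t = (let R = {r. 0 < r \<and> 0 < 1 - t * \<beta> r} in
     if R = {} then -\<infinity> else (INF r\<in>R. ereal (r / (1 - t * \<beta> r))))"

definition \<xi>2 :: "(real \<Rightarrow> real) \<Rightarrow> real \<Rightarrow> ereal" where
  "\<xi>2 \<beta> t = (let R = {r. 0 < r \<and> 0 < t - \<beta> r} in
     if R = {} then -\<infinity> else (INF r\<in>R. ereal (r / (t - \<beta> r))))"

text \<open>
  The supremum is taken among the integers \<open>\<ge> n0\<close>, so that of the empty set is \<open>n0\<close>.
  The empty set does occur: if \<open>\<beta>\<close> is bounded, then \<open>\<xi>1 \<beta> t = 0\<close> for all small \<open>t > 0\<close>.
\<close>

definition N0 :: "(real \<Rightarrow> real) \<Rightarrow> real \<Rightarrow> real \<Rightarrow> nat \<Rightarrow> real \<Rightarrow> ereal" where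
  "N0 \<beta> \<delta> C n0 s =
     (let A = {n. n0 \<le> n \<and> ereal s < ereal (C * real n) * \<xi>1 \<beta> (\<delta> powr (- real n + 1))} in
      if A = {} then ereal (real n0) else (SUP n\<in>A. ereal (real n)))"

end

theory Submission
  imports Defs
begin

text \<open>
  (1) Put \<open>A = \<mu>(f\<^sup>2)\<close> and cut \<open>f\<close> at the levels \<open>\<bar>f\<bar> = (A \<delta>\<^sup>n)\<^sup>1\<^sup>/\<^sup>2\<close>. The layers \<open>h\<^sub>n\<close> are in the domain, with
  \<open>\<Sum> E(h\<^sub>n, h\<^sub>n) \<le> E(f, f)\<close>. Since \<open>h\<^sub>n\<close> lives on a set of measure at most \<open>\<delta>\<^sup>-\<^sup>n\<close>, Cauchy--Schwarz absorbs
  the \<open>L\<^sup>1\<close> term of the SPI and gives \<open>\<mu>(h\<^sub>n\<^sup>2) \<le> \<xi>\<^sub>1(\<delta>\<^sup>-\<^sup>n) E(h\<^sub>n, h\<^sub>n)\<close>. Pointwise, \<open>f\<^sup>2 log (f\<^sup>2 / A)\<close> is at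
  most \<open>(1 + L) f\<^sup>2 log \<delta>\<close> plus a multiple of \<open>\<Sum> (n + 2) h\<^sub>n\<^sup>2\<close> over \<open>n \<ge> L\<close>. With \<open>L = N\<^sub>0(s)\<close> the integral of
  the sum is at most \<open>s E(f, f)\<close>.

  (2) Jensen's inequality gives \<open>Ent(f\<^sup>2) \<ge> \<mu>(f\<^sup>2) log (\<mu>(f\<^sup>2) / \<mu>(\<bar>f\<bar>)\<^sup>2)\<close>. Either
  \<open>\<mu>(f\<^sup>2) \<le> \<delta>\<^sup>k \<mu>(\<bar>f\<bar>)\<^sup>2\<close>, or the logarithm is at least \<open>k log \<delta>\<close> and the SLSI gives
  \<open>\<mu>(f\<^sup>2) \<le> \<xi>\<^sub>2(k log \<delta>) E(f, f)\<close>.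
\<close>

text \<open>For \<open>0 < e\<close> the quotient \<open>x / e\<close> is a lower bound of the
  family, hence of its infimum; \<open>e = 0\<close> forces \<open>x \<le> 0\<close>. This turns a
  bound on \<open>\<xi>1\<close> or \<open>\<xi>2\<close> into an inequality between reals, whether
  or not the infimum is attained.\<close>

lemma INF_ereal_mult_bound:
  fixes g :: "'b \<Rightarrow> real"
  assumes "R \<noteq> {}" "\<And>r. r \<in> R \<Longrightarrow> x \<le> g r * e" "0 \<le> e" "0 < c"
    and "ereal c * (INF r\<in>R. ereal (g r)) \<le> ereal s"
  shows "c * x \<le> s * e"
proof (cases "e = 0")
  case True
  then have "x \<le> 0" using assms(1,2) by force
  then show ?thesis using True \<open>0 < c\<close> by (simp add: mult_le_0_iff)
next
  case False
  then have e: "0 < e" using assms(3) by simp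
  have "ereal (x / e) \<le> (INF r\<in>R. ereal (g r))"
    using assms(2) e by (intro INF_greatest) (simp add: divide_le_eq)
  then have "ereal c * ereal (x / e) \<le> ereal c * (INF r\<in>R. ereal (g r))"
    using \<open>0 < c\<close> by (intro ereal_mult_left_mono) auto
  also note assms(5)
  finally show ?thesis using e by (simp add: divide_le_eq)
qed

section \<open>Soft thresholding and the layers of a real number\<close>

definition soft_threshold :: "real \<Rightarrow> real \<Rightarrow> real" where
  "soft_threshold a x = x - max (- a) (min x a)"

text \<open>Layers can be peeled off one at a time: the part between \<open>a\<close> and
  \<open>b\<close> is the clip of what remains above \<open>a\<close>, so an energy estimate for
  clips can be iterated.\<close>

lemma soft_threshold_diff:
  assumes "0 \<le> a" "a \<le> b"
  shows "soft_threshold a x - soft_threshold b x =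
    max (- (b - a)) (min (soft_threshold a x) (b - a))"
  using assms unfolding soft_threshold_def by linarith

lemma soft_threshold_diff_eq_0:
  assumes "0 \<le> a" "a \<le> b" "\<bar>x\<bar> \<le> a"
  shows "soft_threshold a x - soft_threshold b x = 0"
  using assms unfolding soft_threshold_def by linarith

lemma soft_threshold_diff_square:
  assumes "0 \<le> a" "a \<le> b" "b \<le> \<bar>x\<bar>"
  shows "(soft_threshold a x - soft_threshold b x)\<^sup>2 = (b - a)\<^sup>2"
proof -
  have "\<bar>soft_threshold a x - soft_threshold b x\<bar> = \<bar>b - a\<bar>"
    using assms unfolding soft_threshold_def by linarith
  then show ?thesis by (metis power2_abs)
qed

definition level :: "real \<Rightarrow> real \<Rightarrow> nat \<Rightarrow> real" where
  "level A d n = sqrt A * sqrt d ^ n"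

definition layer :: "real \<Rightarrow> real \<Rightarrow> nat \<Rightarrow> real \<Rightarrow> real" where
  "layer A d n x = soft_threshold (level A d n) x - soft_threshold (level A d (Suc n)) x"

context
  fixes A d :: real
  assumes A: "0 < A" and d: "1 < d"
begin

lemma level_pos: "0 < level A d n"
  using A d by (simp add: level_def)

lemma strict_mono_level: "strict_mono (level A d)"
  using A d by (auto simp: strict_mono_Suc_iff level_def)

lemma level_le_Suc: "level A d n \<le> level A d (Suc n)"
  using strict_mono_level by (simp add: strict_mono_Suc_iff less_imp_le)

lemma level_square: "(level A d n)\<^sup>2 = A * d ^ n"
  using A d by (simp add: level_def power_mult_distrib flip: power_mult)
    (simp add: mult.commute[of n] power_mult)

lemma level_le_abs_iff: "level A d n \<le> \<bar>x\<bar> \<longleftrightarrow> A * d ^ n \<le> x\<^sup>2"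
  using abs_le_square_iff[of "level A d n" x] level_pos[of n] by (simp add: level_square)

lemma layer_eq_0:
  assumes "x\<^sup>2 \<le> A * d ^ n" shows "layer A d n x = 0"
proof -
  have "\<bar>x\<bar> \<le> level A d n"
    using assms abs_le_square_iff[of x "level A d n"] level_pos[of n] by (simp add: level_square)
  then show ?thesis
    using soft_threshold_diff_eq_0[of "level A d n" "level A d (Suc n)" x] level_pos[of n]
      level_le_Suc[of n] by (simp add: layer_def)
qed

lemma layer_square:
  assumes "A * d ^ Suc n \<le> x\<^sup>2" shows "(layer A d n x)\<^sup>2 = A * d ^ n * (sqrt d - 1)\<^sup>2"
proof -
  have "(layer A d n x)\<^sup>2 = (level A d (Suc n) - level A d n)\<^sup>2"
    using assms level_pos[of n] level_le_Suc[of n]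
    by (auto simp: layer_def level_le_abs_iff intro!: soft_threshold_diff_square)
  also have "\<dots> = (level A d n)\<^sup>2 * (sqrt d - 1)\<^sup>2"
    by (simp add: level_def power2_eq_square algebra_simps)
  finally show ?thesis by (simp add: level_square)
qed

lemma eventually_layer_eq_0:
  obtains k where "\<And>n. k \<le> n \<Longrightarrow> layer A d n x = 0"
proof -
  obtain k where k: "x\<^sup>2 / A < d ^ k" using real_arch_pow[OF d] by blast
  have "layer A d n x = 0" if "k \<le> n" for n
  proof (rule layer_eq_0)
    have "x\<^sup>2 / A \<le> d ^ n" using k power_increasing[OF that, of d] d by linarith
    then show "x\<^sup>2 \<le> A * d ^ n" using A by (simp add: field_simps)
  qed
  then show thesis by (rule that)
qed

text \<open>At a fixed \<open>x\<close> all but finitely many layers vanish, so the weights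
  \<open>c\<close> may be arbitrary.\<close>

lemma summable_layers: "summable (\<lambda>i. c i * (layer A d (L + i) x)\<^sup>2)"
proof -
  obtain k where k: "\<And>n. k \<le> n \<Longrightarrow> layer A d n x = 0" using eventually_layer_eq_0 by blast
  show ?thesis by (rule summable_finite[of "{..<k}"]) (auto simp: k)
qed

text \<open>Below \<open>A * d ^ Suc L\<close> the logarithm is at most
  \<open>(1 + L) * ln d\<close>. Otherwise a single summand suffices: if \<open>m\<close> is the
  first exponent with \<open>x\<^sup>2 < A * d ^ m\<close>, layer \<open>m - 2\<close> is crossed
  completely, and the factor \<open>d\<^sup>2 / (sqrt d - 1)\<^sup>2\<close> raises its square to
  \<open>A * d ^ m\<close>.\<close>

lemma square_ln_le_layers:
  "x\<^sup>2 * ln (x\<^sup>2 / A) \<le> (1 + real L) * ln d * x\<^sup>2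
    + (\<Sum>i. ln d * d\<^sup>2 / (sqrt d - 1)\<^sup>2 * real (L + i + 2) * (layer A d (L + i) x)\<^sup>2)"
    (is "_ \<le> _ + suminf ?T")
proof -
  have q: "0 < sqrt d - 1" using d by simp
  have ld: "0 < ln d" using d by simp
  have T: "0 \<le> ?T i" for i using ld by simp
  have ST: "summable ?T" by (rule summable_layers)
  have ln_le: "x\<^sup>2 * ln (x\<^sup>2 / A) \<le> x\<^sup>2 * (real n * ln d)" if "x\<^sup>2 < A * d ^ n" for n
  proof (cases "x = 0")
    case False
    have "x\<^sup>2 / A \<le> d ^ n" using that A by (simp add: field_simps)
    then have "ln (x\<^sup>2 / A) \<le> ln (d ^ n)" using False A d by (subst ln_le_cancel_iff) auto
    then show ?thesis using d by (intro mult_left_mono) (auto simp: ln_realpow)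
  qed simp
  show ?thesis
  proof (cases "x\<^sup>2 < A * d ^ Suc L")
    case True
    then show ?thesis using ln_le[OF True] suminf_nonneg[OF ST T] by (simp add: algebra_simps)
  next
    case False
    define m where "m = (LEAST n. x\<^sup>2 < A * d ^ n)"
    obtain k where "x\<^sup>2 / A < d ^ k" using real_arch_pow[OF d] by blast
    then have "x\<^sup>2 < A * d ^ k" using A by (simp add: field_simps)
    then have m: "x\<^sup>2 < A * d ^ m" unfolding m_def by (rule LeastI)
    have less_m: "A * d ^ n \<le> x\<^sup>2" if "n < m" for n
      using not_less_Least[of n] that unfolding m_def by (metis not_less)
    \<comment> \<open>This puts layer \<open>m - 2\<close> among those with index at least
      \<open>L\<close>.\<close>
    have "Suc L < m"
    proof (rule ccontr)
      assume "\<not> Suc L < m"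
      then have "A * d ^ m \<le> A * d ^ Suc L"
        using A d by (intro mult_left_mono power_increasing) auto
      then show False using m False by linarith
    qed
    then obtain i where i: "m = L + i + 2" by (auto dest: less_imp_Suc_add)
    have "x\<^sup>2 * ln (x\<^sup>2 / A) \<le> x\<^sup>2 * (real m * ln d)" by (rule ln_le[OF m])
    also have "\<dots> \<le> (A * d ^ m) * (real m * ln d)"
      using m ld by (intro mult_right_mono) auto
    also have "\<dots> = ?T i"
      using layer_square[OF less_m, of "L + i"] i q
      by (simp add: power_add power2_eq_square)
    also have "\<dots> \<le> suminf ?T"
      using sum_le_suminf[OF ST, of "{i}"] T by simp
    finally show ?thesis using ld by (simp add: add_increasing)
  qed
qed

end

section \<open>Contractions and layers in a conservative Dirichlet form\<close>

text \<open>\<open>one_in_D\<close> is what gives \<open>form_one\<close> its meaning, since the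
  axioms control \<open>E\<close> only on \<open>D\<close>.\<close>

locale conservative_dirichlet_form =
  prob_space M + symmetric_dirichlet_form M D E
  for M :: "'a measure" and D :: "('a \<Rightarrow> real) set"
    and E :: "('a \<Rightarrow> real) \<Rightarrow> ('a \<Rightarrow> real) \<Rightarrow> real" +
  assumes one_in_D: "(\<lambda>_. 1) \<in> D"
    and form_one: "f \<in> D \<Longrightarrow> E f (\<lambda>_. 1) = 0"
begin

lemma D_measurable [measurable_dest]: "f \<in> D \<Longrightarrow> f \<in> borel_measurable M"
  using domain by (auto simp: L2_def)

lemma D_integrable_square: "f \<in> D \<Longrightarrow> integrable M (\<lambda>x. (f x)\<^sup>2)"
  using domain by (auto simp: L2_def)

lemma D_integrable: "f \<in> D \<Longrightarrow> integrable M f"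
  using D_measurable D_integrable_square square_integrable_imp_integrable by blast

lemma const_in_D: "(\<lambda>_. c) \<in> D"
  using scale[OF one_in_D, of c] by simp

lemma D_diff: "f \<in> D \<Longrightarrow> g \<in> D \<Longrightarrow> (\<lambda>x. f x - g x) \<in> D"
  using add[OF _ scale[of g "-1"], of f] by simp

lemma form_add_scale:
  assumes "u \<in> D" "v \<in> D"
  shows "E (\<lambda>x. u x + c * v x) (\<lambda>x. u x + c * v x) = E u u + 2 * c * E u v + c\<^sup>2 * E v v"
proof -
  have cv: "(\<lambda>x. c * v x) \<in> D" using assms scale by simp
  have uv: "(\<lambda>x. u x + c * v x) \<in> D" using assms cv add by simp
  have "E (\<lambda>x. u x + c * v x) w = E u w + c * E v w" if "w \<in> D" for w
    using form_add[OF assms(1) cv that] form_scale[OF assms(2) that, of c] by simp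
  with assms uv show ?thesis
    using symmetric[OF assms(1) uv] symmetric[OF assms(2) uv] symmetric[OF assms]
    by (simp add: power2_eq_square algebra_simps)
qed

text \<open>The only place where \<open>E(f, 1) = 0\<close> enters: \<open>E\<close> does not see additive constants.\<close>

lemma form_const_add_scale:
  assumes "v \<in> D"
  shows "E (\<lambda>x. a + c * v x) (\<lambda>x. a + c * v x) = c\<^sup>2 * E v v"
proof -
  have 1: "E (\<lambda>_. a) w = 0" if "w \<in> D" for w
    using form_scale[OF one_in_D that, of a] symmetric[OF that one_in_D] form_one[OF that] by simp
  show ?thesis
    using form_add_scale[OF const_in_D assms, of a c] 1[OF assms] 1[OF const_in_D] by simp
qed

text \<open>
  With \<open>\<phi>\<close> the unit contraction of \<open>f\<close>, the function \<open>\<phi> + c (f - \<phi>)\<close> has the same unit contraction for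
  every \<open>c > 0\<close>, so the Markov property yields \<open>E(\<phi>, f - \<phi>) \<ge> 0\<close> by letting \<open>c\<close> tend to \<open>0\<close>.
\<close>

lemma form_unit_contraction_split:
  fixes f :: "'a \<Rightarrow> real"
  defines "\<phi> \<equiv> \<lambda>x. min (max (f x) 0) 1"
  assumes f: "f \<in> D"
  shows "\<phi> \<in> D \<and> E \<phi> \<phi> + E (\<lambda>x. f x - \<phi> x) (\<lambda>x. f x - \<phi> x) \<le> E f f"
proof -
  have \<phi>: "\<phi> \<in> D" using markov[OF f] by (simp add: \<phi>_def)
  define g where "g = (\<lambda>x. f x - \<phi> x)"
  have g: "g \<in> D" unfolding g_def using f \<phi> by (rule D_diff)
  have pos: "0 \<le> 2 * E \<phi> g + c * E g g" if "0 < c" for c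
  proof -
    have "min (max (\<phi> x + c * g x) 0) 1 = \<phi> x" for x
    proof -
      consider "f x < 0" | "0 \<le> f x" "f x \<le> 1" | "1 < f x" by linarith
      then show ?thesis
      proof cases
        case 3
        then have "0 \<le> c * (f x - 1)" using \<open>0 < c\<close> by simp
        then show ?thesis using 3 by (simp add: \<phi>_def g_def)
      qed (use \<open>0 < c\<close> in \<open>auto simp: \<phi>_def g_def mult_le_0_iff max_def\<close>)
    qed
    then have "E \<phi> \<phi> \<le> E (\<lambda>x. \<phi> x + c * g x) (\<lambda>x. \<phi> x + c * g x)"
      using markov[OF add[OF \<phi> scale[OF g, of c]]] by simp
    then have "0 \<le> c * (2 * E \<phi> g + c * E g g)"
      using form_add_scale[OF \<phi> g, of c] by (simp add: power2_eq_square algebra_simps)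
    then show ?thesis using \<open>0 < c\<close> by (simp add: zero_le_mult_iff)
  qed
  have "((\<lambda>c. 2 * E \<phi> g + c * E g g) \<longlongrightarrow> 2 * E \<phi> g + 0 * E g g) (at_right 0)"
    by (intro tendsto_intros)
  then have "0 \<le> 2 * E \<phi> g + 0 * E g g"
    by (rule tendsto_lowerbound) (use pos in \<open>auto simp: eventually_at_right_less eventually_at_filter\<close>)
  then show ?thesis
    using form_add_scale[OF \<phi> g, of 1] \<phi> by (simp add: g_def)
qed

text \<open>The clip is the affine image \<open>a + (b - a) * \<psi>\<close> of the unit contraction
  \<open>\<psi>\<close> of \<open>(f - a) / (b - a)\<close>. Additive constants do not change the
  energy, and all three energies scale by the square of \<open>b - a\<close>.\<close>

lemma form_clip_split:
  fixes f :: "'a \<Rightarrow> real"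
  defines "\<phi> \<equiv> \<lambda>a b x. max a (min (f x) b)"
  assumes f: "f \<in> D" and "a < b"
  shows "\<phi> a b \<in> D \<and>
    E (\<phi> a b) (\<phi> a b) + E (\<lambda>x. f x - \<phi> a b x) (\<lambda>x. f x - \<phi> a b x) \<le> E f f"
proof -
  define d where "d = b - a"
  have d: "0 < d" using \<open>a < b\<close> by (simp add: d_def)
  define u where "u = (\<lambda>x. - (a / d) + (1 / d) * f x)"
  define \<psi> where "\<psi> = (\<lambda>x. min (max (u x) 0) 1)"
  have u: "u \<in> D" unfolding u_def by (intro add const_in_D scale f)
  have f_eq: "f = (\<lambda>x. a + d * u x)" using d by (auto simp: u_def field_simps)
  have \<phi>_eq: "\<phi> a b = (\<lambda>x. a + d * \<psi> x)"
  proof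
    fix x
    have "a + d * min (max (u x) 0) 1 = a + min (max (d * u x) 0) d"
      using d by (simp add: min_mult_distrib_left max_mult_distrib_left)
    also have "d * u x = f x - a" by (simp add: f_eq)
    finally show "\<phi> a b x = a + d * \<psi> x"
      using d unfolding \<phi>_def \<psi>_def d_def by linarith
  qed
  \<comment> \<open>The summand 0 gives the shape required by
    \<open>form_const_add_scale\<close>.\<close>
  have diff_eq: "(\<lambda>x. f x - \<phi> a b x) = (\<lambda>x. 0 + d * (u x - \<psi> x))"
    unfolding f_eq \<phi>_eq by (simp add: algebra_simps)
  have \<psi>: "\<psi> \<in> D" and le: "E \<psi> \<psi> + E (\<lambda>x. u x - \<psi> x) (\<lambda>x. u x - \<psi> x) \<le> E u u"
    using form_unit_contraction_split[OF u] by (auto simp: \<psi>_def)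
  have "\<phi> a b \<in> D" unfolding \<phi>_eq by (intro add const_in_D scale \<psi>)
  moreover have "E (\<phi> a b) (\<phi> a b) + E (\<lambda>x. f x - \<phi> a b x) (\<lambda>x. f x - \<phi> a b x)
      = d\<^sup>2 * (E \<psi> \<psi> + E (\<lambda>x. u x - \<psi> x) (\<lambda>x. u x - \<psi> x))"
    unfolding diff_eq unfolding \<phi>_eq form_const_add_scale[OF \<psi>]
      form_const_add_scale[OF D_diff[OF u \<psi>]] by (simp add: algebra_simps)
  moreover have "E f f = d\<^sup>2 * E u u"
    unfolding f_eq by (rule form_const_add_scale[OF u])
  ultimately show ?thesis using le by (simp add: mult_left_mono)
qed

lemma soft_threshold_in_D:
  assumes "f \<in> D" "0 < a"
  shows "(\<lambda>x. soft_threshold a (f x)) \<in> D"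
    and "E (\<lambda>x. soft_threshold a (f x)) (\<lambda>x. soft_threshold a (f x)) \<le> E f f"
  using form_clip_split[OF assms(1), of "- a" a] assms D_diff[OF assms(1)] nonneg
  unfolding soft_threshold_def by force+

lemma layer_in_D:
  assumes "f \<in> D" "0 < a" "a < b"
  shows "(\<lambda>x. soft_threshold a (f x) - soft_threshold b (f x)) \<in> D"
  using assms by (intro D_diff soft_threshold_in_D) auto

text \<open>Each remainder \<open>G n\<close> splits into the layer \<open>h f n\<close>, which is a
  clip of it, and \<open>G (Suc n)\<close>. By \<open>form_clip_split\<close> the energy of a layer
  is at most the drop in the energy of the remainders, and the drops telescope.\<close>

lemma sum_form_layers_le:
  fixes a :: "nat \<Rightarrow> real"
  defines "h \<equiv> \<lambda>f n x. soft_threshold (a n) (f x) - soft_threshold (a (Suc n)) (f x)"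
  assumes f: "f \<in> D" and a0: "0 < a 0" and "strict_mono a"
  shows "(\<Sum>i<k. E (h f i) (h f i)) \<le> E f f"
proof -
  define G where "G = (\<lambda>n x. soft_threshold (a n) (f x))"
  have mono: "a n < a (Suc n)" for n using \<open>strict_mono a\<close> by (simp add: strict_mono_def)
  have pos: "0 < a n" for n
    by (induction n) (use a0 mono less_trans in blast)+
  have G: "G n \<in> D" "E (G n) (G n) \<le> E f f" for n
    using soft_threshold_in_D[OF f pos] by (auto simp: G_def)
  have "E (h f n) (h f n) + E (G (Suc n)) (G (Suc n)) \<le> E (G n) (G n)" for n
  proof -
    have "h f n = (\<lambda>x. max (- (a (Suc n) - a n)) (min (G n x) (a (Suc n) - a n)))"
      using soft_threshold_diff[of "a n" "a (Suc n)"] pos[of n] mono[of n]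
      by (auto simp: h_def G_def)
    moreover have "G (Suc n) = (\<lambda>x. G n x - h f n x)" by (simp add: G_def h_def)
    ultimately show ?thesis
      using form_clip_split[OF G(1)[of n], of "- (a (Suc n) - a n)" "a (Suc n) - a n"] mono[of n]
      by simp
  qed
  then have "(\<Sum>i<k. E (h f i) (h f i)) \<le> (\<Sum>i<k. E (G i) (G i) - E (G (Suc i)) (G (Suc i)))"
    by (intro sum_mono) (simp add: algebra_simps)
  also have "\<dots> = E (G 0) (G 0) - E (G k) (G k)"
    by (rule sum_lessThan_telescope')
  also have "\<dots> \<le> E f f" using G(2)[of 0] nonneg[OF G(1)[of k]] by linarith
  finally show ?thesis .
qed

section \<open>From the super-Poincare to the super log-Sobolev inequality\<close>

lemma square_integral_abs_le:
  assumes h: "h \<in> D" and [measurable]: "S \<in> sets M"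
    and "\<And>x. x \<in> space M \<Longrightarrow> x \<notin> S \<Longrightarrow> h x = 0" and "measure M S \<le> t" "0 < t"
  shows "(\<integral>x. \<bar>h x\<bar> \<partial>M)\<^sup>2 \<le> t * (\<integral>x. (h x)\<^sup>2 \<partial>M)"
proof -
  define m where "m = (\<integral>x. \<bar>h x\<bar> \<partial>M)"
  define q where "q = (\<integral>x. (h x)\<^sup>2 \<partial>M)"
  \<comment> \<open>The minimiser of \<open>q - 2 * c * m + c\<^sup>2 * t\<close>; the computation
    is the proof of Cauchy--Schwarz for \<open>\<bar>h\<bar>\<close> and the indicator of
    \<open>S\<close>.\<close>
  define c where "c = m / t"
  have ih: "integrable M (\<lambda>x. (h x)\<^sup>2)" "integrable M (\<lambda>x. \<bar>h x\<bar>)"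
    using D_integrable_square[OF h] D_integrable[OF h] by auto
  have iS: "integrable M (indicator S :: 'a \<Rightarrow> real)" by (simp add: emeasure_eq_measure)
  have "0 \<le> (\<integral>x. (\<bar>h x\<bar> - c * indicator S x)\<^sup>2 \<partial>M)" by simp
  also have "\<dots> = (\<integral>x. (h x)\<^sup>2 - 2 * c * \<bar>h x\<bar> + c\<^sup>2 * indicator S x \<partial>M)"
    using assms(3) by (intro Bochner_Integration.integral_cong)
      (auto simp: power2_eq_square algebra_simps indicator_def)
  also have "\<dots> = q - 2 * c * m + c\<^sup>2 * measure M S"
    using ih iS by (simp add: m_def q_def)
  also have "\<dots> \<le> q - 2 * c * m + c\<^sup>2 * t"
    using assms(4) by (simp add: mult_left_mono)
  also have "\<dots> = q - m\<^sup>2 / t"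
    using \<open>0 < t\<close> by (simp add: c_def power2_eq_square field_simps)
  finally show ?thesis using \<open>0 < t\<close> by (simp add: field_simps m_def q_def)
qed

lemma measure_abs_ge_le:
  assumes f: "f \<in> D" and "0 < a"
  shows "measure M {x \<in> space M. a \<le> \<bar>f x\<bar>} \<le> (\<integral>x. (f x)\<^sup>2 \<partial>M) / a\<^sup>2"
proof -
  have "{x \<in> space M. a \<le> \<bar>f x\<bar>} = {x \<in> space M. a\<^sup>2 \<le> (f x)\<^sup>2}"
    using \<open>0 < a\<close> abs_le_square_iff[of a] by auto
  then show ?thesis
    using integral_Markov_inequality_measure[OF D_integrable_square[OF f], of "{}" "a\<^sup>2"] \<open>0 < a\<close>
    by simp
qed

text \<open>Every admissible \<open>r\<close> gives a Poincare inequality for \<open>h\<close> after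
  absorption, and the infimum over \<open>r\<close> is taken at the end. The witness
  \<open>r0\<close> makes the admissible set nonempty; if \<open>\<xi>1\<close> were -infinity, its
  bound by \<open>s\<close> would carry no information.\<close>

lemma Poincare_small_support:
  assumes spi: "SPI M D E \<beta>" and h: "h \<in> D" and S: "S \<in> sets M"
    and supp: "\<And>x. x \<in> space M \<Longrightarrow> x \<notin> S \<Longrightarrow> h x = 0" and t: "measure M S \<le> t" "0 < t"
    and R: "0 < r0" "t * \<beta> r0 < 1"
    and C: "0 < C" "ereal C * \<xi>1 \<beta> t \<le> ereal s"
  shows "C * (\<integral>x. (h x)\<^sup>2 \<partial>M) \<le> s * E h h"
proof (rule INF_ereal_mult_bound)
  let ?R = "{r. 0 < r \<and> 0 < 1 - t * \<beta> r}"
  show "?R \<noteq> {}" using R by auto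
  then show "ereal C * (INF r\<in>?R. ereal (r / (1 - t * \<beta> r))) \<le> ereal s"
    using C by (simp only: \<xi>1_def Let_def if_False)
  fix r assume r: "r \<in> ?R"
  let ?q = "\<integral>x. (h x)\<^sup>2 \<partial>M"
  have "?q \<le> r * E h h + \<beta> r * (\<integral>x. \<bar>h x\<bar> \<partial>M)\<^sup>2"
    using spi r h by (auto simp: SPI_def)
  also have "\<dots> \<le> r * E h h + \<beta> r * (t * ?q)"
    using spi r square_integral_abs_le[OF h S supp t]
    by (intro add_left_mono mult_left_mono) (auto simp: SPI_def rate_function_def)
  finally have "?q * (1 - t * \<beta> r) \<le> r * E h h" by (simp add: algebra_simps)
  then show "?q \<le> r / (1 - t * \<beta> r) * E h h"
    using r by (simp add: field_simps)
qed (use C nonneg[OF h] in auto)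

text \<open>Each summand is controlled by the energy of one layer, and these energies add up to at
  most \<open>E f f\<close>. The resulting bound on all partial sums justifies exchanging sum and
  integral.\<close>

lemma
  assumes spi: "SPI M D E \<beta>" and d: "1 < d" and f: "f \<in> D" and A: "0 < (\<integral>x. (f x)\<^sup>2 \<partial>M)"
    and r0: "0 < r0" "\<beta> r0 < d ^ L" and s: "0 \<le> s"
    and \<xi>: "\<And>n. L < n \<Longrightarrow> ereal (2 * (ln d * d\<^sup>2 / (sqrt d - 1)\<^sup>2) * real n)
        * \<xi>1 \<beta> (d powr (- real n + 1)) \<le> ereal s"
  defines "T \<equiv> \<lambda>i x. ln d * d\<^sup>2 / (sqrt d - 1)\<^sup>2 * real (L + i + 2)
        * (layer (\<integral>x. (f x)\<^sup>2 \<partial>M) d (L + i) (f x))\<^sup>2"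
  shows integrable_layers: "integrable M (\<lambda>x. \<Sum>i. T i x)"
    and integral_layers_le: "(\<integral>x. (\<Sum>i. T i x) \<partial>M) \<le> s * E f f"
proof -
  define A' where "A' = (\<integral>x. (f x)\<^sup>2 \<partial>M)"
  define K where "K = ln d * d\<^sup>2 / (sqrt d - 1)\<^sup>2"
  define h where "h = (\<lambda>n x. layer A' d n (f x))"
  have A': "0 < A'" using A by (simp add: A'_def)
  have K: "0 < K" using d by (simp add: K_def)
  note lv = level_pos[OF A' d] strict_mono_level[OF A' d]
  have h: "h n \<in> D" for n
    using layer_in_D[OF f lv(1), of n "level A' d (Suc n)"] lv(2)
    by (simp add: h_def layer_def strict_mono_Suc_iff)
  have T_eq: "T = (\<lambda>i x. K * real (L + i + 2) * (h (L + i) x)\<^sup>2)"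
    by (simp add: T_def K_def h_def A'_def)
  have T_nonneg: "0 \<le> T i x" for i x using K by (simp add: T_eq)
  have T_int: "integrable M (T i)" for i
    using D_integrable_square[OF h] by (simp add: T_eq)
  have T_le: "(\<integral>x. T i x \<partial>M) \<le> s * E (h (L + i)) (h (L + i))" for i
  proof -
    \<comment> \<open>The shift by one makes \<open>?t\<close> equal to
      \<open>1 / d ^ (L + i)\<close>, which is Chebyshev's bound for the measure of
      \<open>?S\<close>.\<close>
    let ?n = "L + i + 1" and ?S = "{x \<in> space M. level A' d (L + i) \<le> \<bar>f x\<bar>}"
    let ?t = "d powr (- real ?n + 1)" and ?q = "\<integral>x. (h (L + i) x)\<^sup>2 \<partial>M"
    have t: "?t = 1 / d ^ (L + i)"
      using d powr_realpow[of d "L + i"] powr_minus[of d "real (L + i)"] by (simp add: divide_inverse)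
    have "2 * K * real ?n * ?q \<le> s * E (h (L + i)) (h (L + i))"
    proof (rule Poincare_small_support[OF spi h])
      show "?S \<in> sets M" using D_measurable[OF f] by measurable
      show "h (L + i) x = 0" if "x \<in> space M" "x \<notin> ?S" for x
        using that layer_eq_0[OF A' d] level_le_abs_iff[OF A' d, of "L + i" "f x"]
        by (simp add: h_def)
      show "measure M ?S \<le> ?t"
        using measure_abs_ge_le[OF f lv(1)] A' unfolding t level_square[OF A' d]
        by (simp flip: A'_def)
      show "0 < ?t" using d by simp
      have "\<beta> r0 < d ^ (L + i)"
        using r0(2) power_increasing[of L "L + i" d] d by linarith
      then show "?t * \<beta> r0 < 1" using d unfolding t by (simp add: field_simps)
      show "0 < 2 * K * real ?n" using K by simp
      show "ereal (2 * K * real ?n) * \<xi>1 \<beta> ?t \<le> ereal s"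
        using \<xi>[of ?n] by (simp add: K_def)
    qed (rule r0)
    moreover have "(\<integral>x. T i x \<partial>M) = K * real (L + i + 2) * ?q" by (simp add: T_eq)
    \<comment> \<open>Here \<open>L + i + 2 \<le> 2 * (L + i + 1)\<close>; this is the origin of the
      factor 2 in the hypothesis on \<open>\<xi>1\<close>.\<close>
    moreover have "K * real (L + i + 2) * ?q \<le> K * (2 * real ?n) * ?q"
      using K by (intro mult_right_mono mult_left_mono) auto
    ultimately show ?thesis by (simp add: mult_ac)
  qed
  have sum_le: "(\<Sum>i<k. \<integral>x. T i x \<partial>M) \<le> s * E f f" for k
  proof -
    have "(\<Sum>i<k. \<integral>x. T i x \<partial>M) \<le> s * (\<Sum>i<k. E (h (L + i)) (h (L + i)))"
      unfolding sum_distrib_left by (intro sum_mono T_le)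
    also have "(\<Sum>i<k. E (h (L + i)) (h (L + i))) \<le> E f f"
      using sum_form_layers_le[OF f, of "\<lambda>i. level A' d (L + i)" k] lv
      by (simp add: h_def layer_def strict_mono_def)
    finally show ?thesis using s by (simp add: mult_left_mono)
  qed
  have sm: "summable (\<lambda>i. \<integral>x. T i x \<partial>M)"
    by (rule summableI_nonneg_bounded[OF _ sum_le]) (simp add: T_nonneg)
  have AE_sm: "AE x in M. summable (\<lambda>i. norm (T i x))"
    using summable_layers[OF A' d] T_nonneg by (simp add: T_eq h_def)
  have sm_norm: "summable (\<lambda>i. \<integral>x. norm (T i x) \<partial>M)"
    using sm T_nonneg by simp
  show "integrable M (\<lambda>x. \<Sum>i. T i x)"
    by (rule integrable_suminf[OF T_int AE_sm sm_norm])
  show "(\<integral>x. (\<Sum>i. T i x) \<partial>M) \<le> s * E f f"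
    unfolding integral_suminf[OF T_int AE_sm sm_norm] by (rule suminf_le_const[OF sm sum_le])
qed

lemma square_ln_split:
  "(0::real) < A \<Longrightarrow> x\<^sup>2 * ln (x\<^sup>2) = x\<^sup>2 * ln (x\<^sup>2 / A) + ln A * x\<^sup>2"
  by (cases "x = 0") (simp_all add: ln_div algebra_simps)

text \<open>The pointwise bound \<open>P \<le> G\<close> is integrated. Integrability of
  \<open>P\<close> has to be shown first, because \<open>Ent\<close> is infinite without it.\<close>

lemma Ent_le_of_SPI:
  assumes spi: "SPI M D E \<beta>" and d: "1 < d" and f: "f \<in> D"
    and r0: "0 < r0" "\<beta> r0 < d ^ L" and s: "0 \<le> s"
    and \<xi>: "\<And>n. L < n \<Longrightarrow> ereal (2 * (ln d * d\<^sup>2 / (sqrt d - 1)\<^sup>2) * real n)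
        * \<xi>1 \<beta> (d powr (- real n + 1)) \<le> ereal s"
  shows "Ent M (\<lambda>x. (f x)\<^sup>2) \<le> ereal (s * E f f + ln d * (1 + real L) * (\<integral>x. (f x)\<^sup>2 \<partial>M))"
proof -
  define A where "A = (\<integral>x. (f x)\<^sup>2 \<partial>M)"
  note [measurable] = D_measurable[OF f]
  note f2 = D_integrable_square[OF f]
  show ?thesis
  proof (cases "A = 0")
    case True
    then have "AE x in M. (f x)\<^sup>2 = 0"
      using integral_nonneg_eq_0_iff_AE[OF f2] by (simp add: A_def)
    then have 0: "AE x in M. (f x)\<^sup>2 * ln ((f x)\<^sup>2) = 0" by eventually_elim simp
    have "integrable M (\<lambda>x. (f x)\<^sup>2 * ln ((f x)\<^sup>2))"
      using 0 by (subst integrable_cong_AE[where g = "\<lambda>_. 0"]) auto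
    moreover have "(\<integral>x. (f x)\<^sup>2 * ln ((f x)\<^sup>2) \<partial>M) = 0"
      using 0 by (rule integral_eq_zero_AE)
    ultimately show ?thesis
      using True s nonneg[OF f] by (simp add: Ent_def flip: A_def)
  next
    case False
    moreover have "0 \<le> A" unfolding A_def by simp
    ultimately have A: "0 < A" by simp
    define T where "T = (\<lambda>x. \<Sum>i. ln d * d\<^sup>2 / (sqrt d - 1)\<^sup>2 * real (L + i + 2)
        * (layer A d (L + i) (f x))\<^sup>2)"
    define G where "G = (\<lambda>x. (1 + real L) * ln d * (f x)\<^sup>2 + T x)"
    define P where "P = (\<lambda>x. (f x)\<^sup>2 * ln ((f x)\<^sup>2 / A))"
    have T: "integrable M T" "(\<integral>x. T x \<partial>M) \<le> s * E f f"
      using integrable_layers[OF spi d f _ r0 s \<xi>] integral_layers_le[OF spi d f _ r0 s \<xi>] A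
      unfolding T_def A_def by auto
    have G: "integrable M G" using T f2 by (simp add: G_def)
    have P_le: "P x \<le> G x" for x
      unfolding P_def G_def T_def by (rule square_ln_le_layers[OF A d])
    \<comment> \<open>An integrable lower bound, from \<open>ln y \<le> y - 1\<close>; with
      \<open>P_le\<close> it squeezes \<open>P\<close> between integrable functions.\<close>
    have P_ge: "(f x)\<^sup>2 - A \<le> P x" for x
    proof (cases "f x = 0")
      case False
      have "ln (A / (f x)\<^sup>2) \<le> A / (f x)\<^sup>2 - 1"
        using A False by (intro ln_le_minus_one) simp
      then have "1 - A / (f x)\<^sup>2 \<le> ln ((f x)\<^sup>2 / A)"
        using A False by (simp add: ln_div)
      then have "(f x)\<^sup>2 * (1 - A / (f x)\<^sup>2) \<le> P x"
        unfolding P_def by (intro mult_left_mono) auto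
      then show ?thesis using False by (simp add: algebra_simps)
    qed (use A in \<open>simp add: P_def\<close>)
    have P: "integrable M P"
    proof (rule Bochner_Integration.integrable_bound)
      show "integrable M (\<lambda>x. \<bar>G x\<bar> + \<bar>(f x)\<^sup>2 - A\<bar>)"
        using G f2 by simp
      show "P \<in> borel_measurable M" unfolding P_def by measurable
      show "AE x in M. norm (P x) \<le> norm (\<bar>G x\<bar> + \<bar>(f x)\<^sup>2 - A\<bar>)"
      proof (rule AE_I2)
        fix x show "norm (P x) \<le> norm (\<bar>G x\<bar> + \<bar>(f x)\<^sup>2 - A\<bar>)"
          using P_le[of x] P_ge[of x] by (simp only: real_norm_def)
      qed
    qed
    have I_eq: "(\<lambda>x. (f x)\<^sup>2 * ln ((f x)\<^sup>2)) = (\<lambda>x. P x + ln A * (f x)\<^sup>2)"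
      unfolding P_def using square_ln_split[OF A] by blast
    \<comment> \<open>The summand \<open>ln A * (f x)\<^sup>2\<close> integrates to
      \<open>A * ln A\<close>, exactly what the entropy subtracts.\<close>
    have "Ent M (\<lambda>x. (f x)\<^sup>2) = ereal (\<integral>x. P x \<partial>M)"
      unfolding Ent_def I_eq using P f2 by (simp flip: A_def)
    also have "(\<integral>x. P x \<partial>M) \<le> (\<integral>x. G x \<partial>M)"
      using P G P_le by (rule integral_mono)
    also have "(\<integral>x. G x \<partial>M) \<le> s * E f f + ln d * (1 + real L) * A"
      using T f2 by (simp add: G_def algebra_simps flip: A_def)
    finally show ?thesis by (simp add: A_def)
  qed
qed

theorem SLSI_of_SPI:
  assumes spi: "SPI M D E \<beta>" and d: "2 < d"
    and lim: "(\<lambda>n. ereal (real n) * \<xi>1 \<beta> (d powr (- real n + 1))) \<longlonglongrightarrow> 0"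
  shows "\<exists>C4>0. \<exists>s0>0. \<exists>n0>0. \<exists>\<beta>SL.
     (\<forall>s\<in>{0<..s0}. ereal (\<beta>SL s) = ereal (ln d) * (1 + N0 \<beta> d C4 n0 s)) \<and>
     (\<forall>s>s0. \<beta>SL s = \<beta>SL s0) \<and> SLSI M D E \<beta>SL"
proof -
  \<comment> \<open>The constant in the hypothesis of \<open>Ent_le_of_SPI\<close>; it serves as
    \<open>C4\<close>.\<close>
  define C where "C = 2 * (ln d * d\<^sup>2 / (sqrt d - 1)\<^sup>2)"
  have C: "0 < C" using d by (simp add: C_def)
  define X where "X = (\<lambda>n. ereal (C * real n) * \<xi>1 \<beta> (d powr (- real n + 1)))"
  \<comment> \<open>From \<open>n0\<close> on, \<open>r = 1\<close> is admissible at
    \<open>d powr (- real n)\<close>. The successor \<open>n1\<close> is taken so that the starting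
    index is positive.\<close>
  obtain n0 where n0: "\<beta> 1 < d ^ n0" using real_arch_pow[of d] d by force
  define n1 where "n1 = Suc n0"
  have n1: "\<beta> 1 < d ^ n" if "n1 \<le> n" for n
    using n0 power_increasing[of n0 n d] that d unfolding n1_def by linarith
  have X_lim: "X \<longlonglongrightarrow> 0"
    using tendsto_cmult_ereal[OF _ lim, of "ereal C"] by (simp add: X_def mult.assoc flip: times_ereal.simps(1))
  define S where "S = (\<lambda>s. {n. n1 \<le> n \<and> ereal s < X n})"
  have S_fin: "finite (S s)" if "0 < s" for s
  proof -
    have "eventually (\<lambda>n. X n < ereal s) sequentially"
      using order_tendstoD(2)[OF X_lim, of "ereal s"] that by simp
    then obtain k where "\<And>n. k \<le> n \<Longrightarrow> X n < ereal s" by (auto simp: eventually_sequentially)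
    then have "S s \<subseteq> {..<k}" unfolding S_def
      by (metis (no_types, lifting) lessThan_iff mem_Collect_eq not_less order_less_asym subsetI)
    then show ?thesis by (rule finite_subset) simp
  qed
  \<comment> \<open>\<open>S s\<close> is finite, so the supremum in \<open>N0\<close> is a maximum;
    \<open>n1\<close> is the value of \<open>N0\<close> on the empty set.\<close>
  define L where "L = (\<lambda>s. if S s = {} then n1 else Max (S s))"
  have L_ge: "n1 \<le> L s" if "0 < s" for s
    using Max_in[OF S_fin[OF that]] by (auto simp: L_def S_def)
  have L_less: "X n \<le> ereal s" if "0 < s" "L s < n" for s n
  proof (rule ccontr)
    assume "\<not> X n \<le> ereal s"
    then have "n \<in> S s" using L_ge[OF that(1)] that(2) by (simp add: S_def)
    then show False
      using Max_ge[OF S_fin[OF that(1)], of n] that(2) by (auto simp: L_def split: if_splits)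
  qed
  have L_anti: "L s' \<le> L s" if "0 < s" "s \<le> s'" for s s'
  proof (cases "S s' = {}")
    case True
    then show ?thesis using L_ge[OF that(1)] by (simp add: L_def)
  next
    case False
    have "S s' \<subseteq> S s"
      using that(2) unfolding S_def by (auto intro: le_less_trans[of "ereal s" "ereal s'"])
    then show ?thesis
      using False Max_mono[OF _ False S_fin[OF that(1)]] by (auto simp: L_def)
  qed
  have N0_S: "N0 \<beta> d C n1 s = (if S s = {} then ereal (real n1)
      else SUP n\<in>S s. ereal (real n))" for s
    by (simp only: N0_def S_def X_def Let_def)
  have N0_eq: "N0 \<beta> d C n1 s = ereal (real (L s))" if "0 < s" for s
  proof (cases "S s = {}")
    case True
    then show ?thesis by (simp add: N0_S L_def)
  next
    case False
    have "(SUP n\<in>S s. ereal (real n)) = ereal (real (Max (S s)))"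
      using Max_in[OF S_fin[OF that] False] Max_ge[OF S_fin[OF that]]
      by (intro SUP_eqI) auto
    then show ?thesis using False by (simp add: N0_S L_def)
  qed
  \<comment> \<open>With \<open>s0 = 1\<close> the rate is frozen beyond 1. The inequality at
    \<open>min s 1\<close> implies the one at \<open>s\<close> because the energy is
    nonnegative.\<close>
  define B where "B = (\<lambda>s. ln d * (1 + real (L (min s 1))))"
  have ld: "0 < ln d" using d by simp
  have "SLSI M D E B"
    unfolding SLSI_def rate_function_def
  proof (intro conjI allI impI ballI)
    show "0 \<le> B s" for s using ld by (simp add: B_def)
    show "antimono_on {0<..} B"
      using ld by (auto intro!: monotone_onI mult_left_mono L_anti simp: B_def)
    fix s :: real and f assume s: "0 < s" and f: "f \<in> D"
    let ?s = "min s 1"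
    have "0 < ?s" using s by simp
    then have "Ent M (\<lambda>x. (f x)\<^sup>2)
        \<le> ereal (?s * E f f + ln d * (1 + real (L ?s)) * (\<integral>x. (f x)\<^sup>2 \<partial>M))"
      using L_less[of ?s] d
      by (intro Ent_le_of_SPI[OF spi _ f zero_less_one n1[OF L_ge]]) (auto simp: X_def C_def)
    also have "\<dots> \<le> ereal (s * E f f + B s * (\<integral>x. (f x)\<^sup>2 \<partial>M))"
      using nonneg[OF f] by (simp add: B_def mult_right_mono)
    finally show "Ent M (\<lambda>x. (f x)\<^sup>2) \<le> ereal (s * E f f + B s * (\<integral>x. (f x)\<^sup>2 \<partial>M))" .
  qed
  moreover have "\<forall>s\<in>{0<..1}. ereal (B s) = ereal (ln d) * (1 + N0 \<beta> d C n1 s)"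
    by (simp add: N0_eq B_def min_absorb1 one_ereal_def)
  moreover have "\<forall>s>1. B s = B 1" by (simp add: B_def)
  moreover have "0 < n1" by (simp add: n1_def)
  ultimately show ?thesis using C zero_less_one by blast
qed

section \<open>From the super log-Sobolev to the super-Poincare inequality\<close>

text \<open>
  Jensen's inequality for the logarithm and the measure \<open>f\<^sup>2 \<mu>\<close>, through the tangent bound
  \<open>f\<^sup>2 ln \<bar>f\<bar> \<ge> f\<^sup>2 ln a + f\<^sup>2 - a \<bar>f\<bar>\<close> at \<open>a = \<mu>(f\<^sup>2) / \<mu>(\<bar>f\<bar>)\<close>.
\<close>

lemma Ent_square_ge:
  assumes f: "f \<in> D" and A: "0 < (\<integral>x. (f x)\<^sup>2 \<partial>M)"
  shows "0 < (\<integral>x. \<bar>f x\<bar> \<partial>M)"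
    and "ereal ((\<integral>x. (f x)\<^sup>2 \<partial>M) * ln ((\<integral>x. (f x)\<^sup>2 \<partial>M) / (\<integral>x. \<bar>f x\<bar> \<partial>M)\<^sup>2))
      \<le> Ent M (\<lambda>x. (f x)\<^sup>2)"
proof -
  define A' where "A' = (\<integral>x. (f x)\<^sup>2 \<partial>M)"
  define m where "m = (\<integral>x. \<bar>f x\<bar> \<partial>M)"
  define a where "a = A' / m"
  have f1: "integrable M (\<lambda>x. \<bar>f x\<bar>)" using D_integrable[OF f] by simp
  note f2 = D_integrable_square[OF f]
  have "m \<noteq> 0"
  proof
    assume "m = 0"
    then have "AE x in M. \<bar>f x\<bar> = 0"
      using integral_nonneg_eq_0_iff_AE[OF f1] by (simp add: m_def)
    then have "AE x in M. (f x)\<^sup>2 = 0" by eventually_elim simp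
    then have "A' = 0" unfolding A'_def by (rule integral_eq_zero_AE)
    then show False using A by (simp add: A'_def)
  qed
  moreover have "0 \<le> m" unfolding m_def by simp
  ultimately have m: "0 < m" by simp
  then show "0 < (\<integral>x. \<bar>f x\<bar> \<partial>M)" by (simp add: m_def)
  have A': "0 < A'" using A by (simp add: A'_def)
  have a: "0 < a" using m A' by (simp add: a_def)
  show "ereal ((\<integral>x. (f x)\<^sup>2 \<partial>M) * ln ((\<integral>x. (f x)\<^sup>2 \<partial>M) / (\<integral>x. \<bar>f x\<bar> \<partial>M)\<^sup>2))
      \<le> Ent M (\<lambda>x. (f x)\<^sup>2)"
  proof (cases "integrable M (\<lambda>x. (f x)\<^sup>2 * ln ((f x)\<^sup>2))")
    case True
    have pt: "2 * ((1 + ln a) * (f x)\<^sup>2 - a * \<bar>f x\<bar>) \<le> (f x)\<^sup>2 * ln ((f x)\<^sup>2)" for x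
    proof (cases "f x = 0")
      case False
      then have "0 < \<bar>f x\<bar>" by simp
      then have "ln (a / \<bar>f x\<bar>) \<le> a / \<bar>f x\<bar> - 1" using a by (intro ln_le_minus_one) simp
      then have "ln a + 1 - a / \<bar>f x\<bar> \<le> ln \<bar>f x\<bar>"
        using a False by (simp add: ln_div)
      then have "\<bar>f x\<bar>\<^sup>2 * (ln a + 1 - a / \<bar>f x\<bar>) \<le> \<bar>f x\<bar>\<^sup>2 * ln \<bar>f x\<bar>"
        by (intro mult_left_mono) auto
      moreover have "\<bar>f x\<bar>\<^sup>2 * (ln a + 1 - a / \<bar>f x\<bar>) = (1 + ln a) * \<bar>f x\<bar>\<^sup>2 - a * \<bar>f x\<bar>"
        using False by (simp add: power2_eq_square field_simps del: abs_mult_self_eq)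
      moreover have "ln (\<bar>f x\<bar>\<^sup>2) = 2 * ln \<bar>f x\<bar>"
        using False by (simp only: ln_realpow zero_less_abs_iff)
      ultimately show ?thesis by simp
    qed simp
    have "(\<integral>x. 2 * ((1 + ln a) * (f x)\<^sup>2 - a * \<bar>f x\<bar>) \<partial>M) \<le> (\<integral>x. (f x)\<^sup>2 * ln ((f x)\<^sup>2) \<partial>M)"
      using f1 f2 True pt by (intro integral_mono) auto
    moreover have "(\<integral>x. 2 * ((1 + ln a) * (f x)\<^sup>2 - a * \<bar>f x\<bar>) \<partial>M) = 2 * ((1 + ln a) * A' - a * m)"
      using f1 f2 by (simp add: A'_def m_def)
    \<comment> \<open>By the choice of \<open>a\<close> the terms without a logarithm
      cancel.\<close>
    moreover have "a * m = A'" using m by (simp add: a_def)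
    ultimately have "2 * ln a * A' \<le> (\<integral>x. (f x)\<^sup>2 * ln ((f x)\<^sup>2) \<partial>M)"
      by (simp add: algebra_simps)
    moreover have "A' * ln (A' / m\<^sup>2) = 2 * ln a * A' - A' * ln A'"
      using m A' by (simp add: a_def ln_div ln_realpow algebra_simps)
    ultimately show ?thesis
      using True by (simp add: Ent_def flip: A'_def m_def)
  qed (simp add: Ent_def)
qed

text \<open>The \<open>d ^ k\<close> term stands on the left so that this side is independent of
  \<open>r\<close>, as \<open>INF_ereal_mult_bound\<close> requires.\<close>

lemma Poincare_of_SLSI:
  assumes slsi: "SLSI M D E \<beta>" and f: "f \<in> D" and d: "0 < d" and r: "0 < r"
    and less: "\<beta> r < real k * ln d"
  shows "(\<integral>x. (f x)\<^sup>2 \<partial>M) - d ^ k * (\<integral>x. \<bar>f x\<bar> \<partial>M)\<^sup>2 \<le> r / (real k * ln d - \<beta> r) * E f f"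
proof (cases "(\<integral>x. (f x)\<^sup>2 \<partial>M) \<le> d ^ k * (\<integral>x. \<bar>f x\<bar> \<partial>M)\<^sup>2")
  case True
  moreover have "0 \<le> r / (real k * ln d - \<beta> r) * E f f"
    using r less nonneg[OF f] by simp
  ultimately show ?thesis by linarith
next
  case False
  define A where "A = (\<integral>x. (f x)\<^sup>2 \<partial>M)"
  define m where "m = (\<integral>x. \<bar>f x\<bar> \<partial>M)"
  have less_A: "d ^ k * m\<^sup>2 < A" using False by (simp add: A_def m_def)
  moreover have "0 \<le> d ^ k * m\<^sup>2" using d by simp
  ultimately have A: "0 < A" by linarith
  then have m: "0 < m" and ent: "ereal (A * ln (A / m\<^sup>2)) \<le> Ent M (\<lambda>x. (f x)\<^sup>2)"
    using Ent_square_ge[OF f] unfolding A_def m_def by auto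
  have "ln (d ^ k) \<le> ln (A / m\<^sup>2)"
    using less_A m d A by (subst ln_le_cancel_iff) (auto simp: field_simps)
  then have "A * (real k * ln d) \<le> A * ln (A / m\<^sup>2)"
    using A d by (simp add: ln_realpow)
  moreover note ent
  moreover have "Ent M (\<lambda>x. (f x)\<^sup>2) \<le> ereal (r * E f f + \<beta> r * A)"
    using slsi r f by (simp add: SLSI_def A_def)
  ultimately have "A * (real k * ln d - \<beta> r) \<le> r * E f f"
    using order_trans by (fastforce simp: algebra_simps)
  then have "A \<le> r / (real k * ln d - \<beta> r) * E f f"
    using less by (simp add: field_simps)
  moreover have "A - d ^ k * m\<^sup>2 \<le> A" using d by simp
  ultimately show ?thesis by (simp add: A_def m_def)
qed

lemma Poincare_of_SLSI_\<xi>2: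
  assumes slsi: "SLSI M D E \<beta>" and f: "f \<in> D" and d: "0 < d" and r: "0 < r"
    and less: "\<beta> r < real k * ln d" and \<xi>: "\<xi>2 \<beta> (real k * ln d) \<le> ereal s"
  shows "(\<integral>x. (f x)\<^sup>2 \<partial>M) \<le> s * E f f + d ^ k * (\<integral>x. \<bar>f x\<bar> \<partial>M)\<^sup>2"
proof -
  let ?R = "{r. 0 < r \<and> 0 < real k * ln d - \<beta> r}"
  have R: "?R \<noteq> {}" using r less by auto
  have "1 * ((\<integral>x. (f x)\<^sup>2 \<partial>M) - d ^ k * (\<integral>x. \<bar>f x\<bar> \<partial>M)\<^sup>2) \<le> s * E f f"
  proof (rule INF_ereal_mult_bound[OF R])
    show "ereal 1 * (INF r\<in>?R. ereal (r / (real k * ln d - \<beta> r))) \<le> ereal s"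
      using \<xi> R by (simp only: \<xi>2_def Let_def if_False flip: one_ereal_def) simp
  qed (use Poincare_of_SLSI[OF slsi f d] nonneg[OF f] in auto)
  then show ?thesis by simp
qed

text \<open>The witnesses are \<open>\<delta> = 3\<close> and \<open>C5 = C6 = 1\<close>.\<close>

theorem SPI_of_SLSI:
  assumes slsi: "SLSI M D E \<beta>"
  shows "\<exists>C5>0. \<exists>C6>0. \<exists>\<delta>>2. \<exists>n0\<ge>2. \<exists>\<beta>SP.
     (\<forall>s>0. ereal (\<beta>SP s) =
        ereal C5 * Inf {ereal (\<delta> ^ k) | k. n0 \<le> k \<and> \<xi>2 \<beta> (real k * ln \<delta>) \<le> ereal (C6 * s)}) \<and>
     SPI M D E \<beta>SP"
proof -
  have l3: "0 < ln (3::real)" by simp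
  \<comment> \<open>Makes \<open>r = 1\<close> admissible in \<open>\<xi>2\<close> at every
    \<open>k \<ge> n0\<close>, so \<open>\<xi>2\<close> is never -infinity there.\<close>
  obtain n where n: "\<beta> 1 < real n * ln 3" using reals_Archimedean3[OF l3] by blast
  define n0 where "n0 = max 2 n"
  have n0: "\<beta> 1 < real k * ln 3" if "n0 \<le> k" for k
  proof -
    have "real n * ln 3 \<le> real k * ln 3" using that l3 by (simp add: n0_def)
    then show ?thesis using n by linarith
  qed
  define P where "P = (\<lambda>s k. n0 \<le> k \<and> \<xi>2 \<beta> (real k * ln 3) \<le> ereal s)"
  \<comment> \<open>Testing the infimum at \<open>r = 1\<close> gives
    \<open>1 / (j * ln 3 - \<beta> 1)\<close>, which is below \<open>s\<close> for large
    \<open>j\<close>.\<close>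
  have ex: "\<exists>k. P s k" if "0 < s" for s
  proof -
    obtain k where k: "\<beta> 1 + 1 / s < real k * ln 3" using reals_Archimedean3[OF l3] by blast
    define j where "j = max n0 k"
    have "real k * ln 3 \<le> real j * ln 3" using l3 by (simp add: j_def)
    then have j: "1 / s < real j * ln 3 - \<beta> 1" using k by linarith
    moreover have "0 < 1 / s" using that by simp
    ultimately have j0: "0 < real j * ln 3 - \<beta> 1" by linarith
    let ?R = "{r. 0 < r \<and> 0 < real j * ln 3 - \<beta> r}"
    have 1: "1 \<in> ?R" using j0 by simp
    then have "?R \<noteq> {}" by blast
    then have "\<xi>2 \<beta> (real j * ln 3) = (INF r\<in>?R. ereal (r / (real j * ln 3 - \<beta> r)))"
      by (simp only: \<xi>2_def Let_def if_False)
    also have "\<dots> \<le> ereal (1 / (real j * ln 3 - \<beta> 1))"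
      using 1 by (rule INF_lower)
    also have "\<dots> \<le> ereal s" using j j0 that by (simp add: field_simps)
    finally have "P s j" by (simp add: P_def j_def)
    then show ?thesis ..
  qed
  \<comment> \<open>Powers of 3 increase, so the infimum is attained at the least admissible
    exponent and is a real number.\<close>
  define B where "B = (\<lambda>s. 3 ^ (LEAST k. P s k) :: real)"
  have P_Least: "P s (LEAST k. P s k)" if "0 < s" for s
    using ex[OF that] by (rule LeastI_ex)
  have "SPI M D E B"
    unfolding SPI_def rate_function_def
  proof (intro conjI allI impI ballI)
    show "0 \<le> B s" for s by (simp add: B_def)
    show "antimono_on {0<..} B"
    proof (rule monotone_onI)
      fix s s' :: real assume "s \<in> {0<..}" "s \<le> s'"
      then have "P s' (LEAST k. P s k)"
        using P_Least[of s] by (auto simp: P_def intro: order_trans)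
      then show "B s' \<le> B s" by (auto simp: B_def intro!: power_increasing Least_le)
    qed
    fix s :: real and f assume "0 < s" and f: "f \<in> D"
    then show "(\<integral>x. (f x)\<^sup>2 \<partial>M) \<le> s * E f f + B s * (\<integral>x. \<bar>f x\<bar> \<partial>M)\<^sup>2"
      using P_Least[of s] n0 unfolding B_def
      by (intro Poincare_of_SLSI_\<xi>2[OF slsi f _ zero_less_one]) (auto simp: P_def)
  qed
  moreover have "ereal (B s) =
      ereal 1 * Inf {ereal (3 ^ k) | k. n0 \<le> k \<and> \<xi>2 \<beta> (real k * ln 3) \<le> ereal (1 * s)}"
    if "0 < s" for s
  proof -
    have "Inf {ereal (3 ^ k) | k. P s k} = ereal (B s)"
      unfolding B_def using P_Least[OF that]
      by (intro Inf_eqI) (auto intro!: power_increasing Least_le)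
    then show ?thesis by (simp add: P_def flip: one_ereal_def)
  qed
  moreover have "2 \<le> n0" by (simp add: n0_def)
  ultimately show ?thesis
    by (intro exI[of _ 1] exI[of _ "3::real"] exI[of _ n0] exI[of _ B] conjI) auto
qed

end

theorem theorem1p2:
  fixes M :: "'a measure"
    and D :: "('a \<Rightarrow> real) set"
    and E :: "('a \<Rightarrow> real) \<Rightarrow> ('a \<Rightarrow> real) \<Rightarrow> real"
  assumes "prob_space M"
    and "symmetric_dirichlet_form M D E"
    and "(\<lambda>_. 1) \<in> D"
    and "\<And>f. f \<in> D \<Longrightarrow> E f (\<lambda>_. 1) = 0"
  shows
    "(\<forall>\<beta>SP \<delta>. SPI M D E \<beta>SP \<longrightarrow> \<delta> > 2 \<longrightarrow>
        (\<lambda>n. ereal (real n) * \<xi>1 \<beta>SP (\<delta> powr (- real n + 1))) \<longlonglongrightarrow> 0 \<longrightarrow>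
        (\<exists>C4>0. \<exists>s0>0. \<exists>n0>0. \<exists>\<beta>SL.
           (\<forall>s\<in>{0<..s0}. ereal (\<beta>SL s) = ereal (ln \<delta>) * (1 + N0 \<beta>SP \<delta> C4 n0 s)) \<and>
           (\<forall>s>s0. \<beta>SL s = \<beta>SL s0) \<and>
           SLSI M D E \<beta>SL)) \<and>
     (\<forall>\<beta>SL. SLSI M D E \<beta>SL \<longrightarrow>
        (\<exists>C5>0. \<exists>C6>0. \<exists>\<delta>>2. \<exists>n0\<ge>2. \<exists>\<beta>SP.
           (\<forall>s>0. ereal (\<beta>SP s) =
              ereal C5 * Inf {ereal (\<delta> ^ k) | k. n0 \<le> k \<and> \<xi>2 \<beta>SL (real k * ln \<delta>) \<le> ereal (C6 * s)}) \<and>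
           SPI M D E \<beta>SP))"
proof -
  interpret conservative_dirichlet_form M D E
    using assms by (intro conservative_dirichlet_form.intro conservative_dirichlet_form_axioms.intro)
  show ?thesis using SLSI_of_SPI SPI_of_SLSI by blast
qed

end
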